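(* For every integer $n\ge 1$, the clique complex $K_n$ of the partition graph $G_n$ is simply connected.
   Context: A partition of a positive integer $n$ is a weakly decreasing sequence $\lambda=(\lambda_1\ge\cdots\ge\lambda_\ell>0)$ of positive integers with sum $n$; it is identified with its Ferrers diagram, the left-justified array with $\lambda_i$ cells in row $i$. The partition graph $G_n$ is the simple graph whose vertices are all partitions of $n$; two distinct partitions are adjacent if one can be obtained from the other by removing one cell from a row of the Ferrers diagram, adding it to another row (possibly a new row, i.e. a row of length $0$), and then reordering the row lengths into weakly decreasing order (discarding zeros). $K_n:=\mathrm{Cl}(G_n)$ is the clique complex of $G_n$: the simplicial complex whose simplices are the finite nonempty cliques of $G_n$. *)

theory Defs
  imports "HOL-Analysis.Analysis" "HOL-Library.Ramsey"
begin

definition partitions :: "nat \<Rightarrow> nat list set" where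
  "partitions n = {xs. sorted_wrt (\<ge>) xs \<and> 0 \<notin> set xs \<and> sum_list xs = n}"

text \<open>The list \<open>xs @ [0]\<close> provides a row of length 0 at index \<open>length xs\<close>; choosing it as the
  target \<open>j\<close> means that the cell is placed in a new row.  The condition \<open>i < length xs\<close> excludes
  removing a cell from that empty row.\<close>

definition move_cell :: "nat list \<Rightarrow> nat \<Rightarrow> nat \<Rightarrow> nat list" where
  "move_cell xs i j =
    (let ys = xs @ [0] in rev (sort (filter (\<lambda>k. k \<noteq> 0) (ys[i := ys ! i - 1, j := ys ! j + 1]))))"

definition cell_move :: "nat list \<Rightarrow> nat list \<Rightarrow> bool" where
  "cell_move xs ys \<longleftrightarrow> (\<exists>i j. i < length xs \<and> j \<le> length xs \<and> i \<noteq> j \<and> ys = move_cell xs i j)"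

definition partition_graph_edges :: "nat \<Rightarrow> nat list set set" where
  "partition_graph_edges n =
    {{xs, ys} | xs ys. xs \<in> partitions n \<and> ys \<in> partitions n \<and> xs \<noteq> ys \<and>
                       (cell_move xs ys \<or> cell_move ys xs)}"

definition clique_complex :: "'a set \<Rightarrow> 'a set set \<Rightarrow> 'a set set" where
  "clique_complex V E = {S. finite S \<and> S \<noteq> {} \<and> S \<subseteq> V \<and> clique S E}"

text \<open>The points of the realization are given by barycentric coordinates, extended by 0 to the
  whole vertex type.  The topology is the one induced by the product topology on \<open>'a \<Rightarrow> real\<close>.  For
  a complex with finitely many simplices (in particular for the clique complex of a finite graph)
  this is the usual topology of the realization; for infinite complexes it may be coarser than
  the weak topology.\<close>

definition geometric_realization :: "'a set set \<Rightarrow> ('a \<Rightarrow> real) set" where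
  "geometric_realization K =
    {f. (\<forall>v. 0 \<le> f v) \<and> {v. f v \<noteq> 0} \<in> K \<and> (\<Sum>v | f v \<noteq> 0. f v) = 1}"

definition partition_complex :: "nat \<Rightarrow> nat list set set" where
  "partition_complex n = clique_complex (partitions n) (partition_graph_edges n)"

end

theory Submission
  imports Defs
begin

text \<open>Order the partitions by the sum of the squares of their parts.  Adjacent partitions have
  different sums, and the neighbours of \<open>\<lambda>\<close> with larger sum arise by moving a cell from a row
  \<open>j\<close> to a row \<open>i\<close> at least as long.  Replacing \<open>i\<close> by a longest row and then varying \<open>j\<close> shows
  that these neighbours span a connected graph, which is nonempty unless \<open>\<lambda> = (n)\<close>.

  This makes the clique complex simply connected.  Join each vertex to \<open>(n)\<close> by a monotone edge path;
  by induction along the order, with triangles filled in, it is unique up to homotopy, and it is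
  compatible with every edge.  Prolonging it within open stars yields for each point \<open>y\<close> a unique
  class of paths \<open>r\<^sub>y\<close> from \<open>(n)\<close> to \<open>y\<close>.  Following a loop \<open>p\<close> based at \<open>x\<close> from star to star
  gives \<open>r\<^sub>x \<cdot> p \<simeq> r\<^sub>x\<close>, so \<open>p\<close> is null-homotopic.\<close>

section \<open>Graphs with connected descending links\<close>

text \<open>Discrete Morse theory on vertices: \<open>g\<close> is a height, and the last two axioms
  make the descending link of every vertex other than the minimum \<open>b\<close> nonempty and
  connected.\<close>

locale morse_graph =
  fixes V :: "'a set" and E :: "'a set set" and g :: "'a \<Rightarrow> nat" and b :: 'a
  assumes b_in: "b \<in> V"
    and b_min: "v \<in> V \<Longrightarrow> g b \<le> g v"
    and g_neq: "\<lbrakk>u \<in> V; v \<in> V; u \<noteq> v; {u, v} \<in> E\<rbrakk> \<Longrightarrow> g u \<noteq> g v"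
    and lower_ne: "\<lbrakk>v \<in> V; v \<noteq> b\<rbrakk> \<Longrightarrow> \<exists>u\<in>V. {u, v} \<in> E \<and> g u < g v"
    and lower_conn:
      "\<lbrakk>v \<in> V; u \<in> V; {u, v} \<in> E; g u < g v; u' \<in> V; {u', v} \<in> E; g u' < g v\<rbrakk> \<Longrightarrow>
       (u, u') \<in> {(x, y). x \<in> V \<and> y \<in> V \<and> {x, v} \<in> E \<and> {y, v} \<in> E \<and> g x < g v \<and> g y < g v \<and> {x, y} \<in> E}\<^sup>*"

text \<open>The functional \<open>c v\<close> plays the role of the barycentric coordinate at
  \<open>v\<close>; being linear on the ambient space, it is continuous on \<open>X\<close> and
  affine on segments.\<close>

locale realized_morse_graph = morse_graph V E g b
  for V :: "'a set" and E g b +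
  fixes e :: "'a \<Rightarrow> 'b::real_normed_vector" and c :: "'a \<Rightarrow> 'b \<Rightarrow> real" and X :: "'b set"
  assumes c_linear: "v \<in> V \<Longrightarrow> bounded_linear (c v)"
    and c_self: "v \<in> V \<Longrightarrow> c v (e v) = 1"
    and hull_sub: "\<sigma> \<in> clique_complex V E \<Longrightarrow> convex hull (e ` \<sigma>) \<subseteq> X"
    and carrier: "y \<in> X \<Longrightarrow>
      \<exists>\<sigma> \<in> clique_complex V E. y \<in> convex hull (e ` \<sigma>) \<and> (\<forall>v\<in>V. c v y > 0 \<longleftrightarrow> v \<in> \<sigma>)"
begin

definition star :: "'a \<Rightarrow> 'b set" where
  "star v = {y \<in> X. c v y > 0}"

text \<open>Edge paths along which \<open>g\<close> increases, built at the far end so that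
  induction on the height of the endpoint strips the last edge.\<close>

inductive dpath :: "'a \<Rightarrow> (real \<Rightarrow> 'b) \<Rightarrow> bool" where
  base: "dpath b (linepath (e b) (e b))"
| step: "\<lbrakk>dpath u p; v \<in> V; {u, v} \<in> E; g u < g v\<rbrakk> \<Longrightarrow> dpath v (p +++ linepath (e u) (e v))"

section \<open>Segments and triangles inside simplices\<close>

lemma simplex1: "v \<in> V \<Longrightarrow> {v} \<in> clique_complex V E"
  by (auto simp: clique_complex_def clique_def)

lemma simplex2: "\<lbrakk>u \<in> V; v \<in> V; {u, v} \<in> E\<rbrakk> \<Longrightarrow> {u, v} \<in> clique_complex V E"
  by (auto simp: clique_complex_def clique_def insert_commute)

lemma simplex3:
  "\<lbrakk>u \<in> V; v \<in> V; w \<in> V; {u, v} \<in> E; {u, w} \<in> E; {v, w} \<in> E\<rbrakk> \<Longrightarrow> {u, v, w} \<in> clique_complex V E"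
  by (auto simp: clique_complex_def clique_def insert_commute)

lemma vertex_in_hull: "v \<in> \<sigma> \<Longrightarrow> e v \<in> convex hull (e ` \<sigma>)"
  by (simp add: hull_inc)

lemma segment_in_X:
  assumes "\<sigma> \<in> clique_complex V E" "x \<in> convex hull (e ` \<sigma>)" "y \<in> convex hull (e ` \<sigma>)"
  shows "closed_segment x y \<subseteq> X"
  using assms hull_sub closed_segment_subset convex_convex_hull by (meson subset_trans)

lemma edge_in_X: "\<lbrakk>u \<in> V; v \<in> V; {u, v} \<in> E\<rbrakk> \<Longrightarrow> closed_segment (e u) (e v) \<subseteq> X"
  by (rule segment_in_X[OF simplex2]) (auto intro: hull_inc)

text \<open>The hull of a simplex is convex, hence simply connected. Arbitrary corners in the hull
  also allow degenerate triangles and corners that are not vertices.\<close>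

lemma homotopic_triangle:
  assumes "\<sigma> \<in> clique_complex V E"
    and "x \<in> convex hull (e ` \<sigma>)" "y \<in> convex hull (e ` \<sigma>)" "z \<in> convex hull (e ` \<sigma>)"
  shows "homotopic_paths X (linepath x z) (linepath x y +++ linepath y z)"
proof -
  have cv: "convex (convex hull (e ` \<sigma>))" by simp
  have "homotopic_paths (convex hull (e ` \<sigma>)) (linepath x z) (linepath x y +++ linepath y z)"
    using convex_imp_simply_connected[OF cv] assms
    unfolding simply_connected_eq_homotopic_paths
    by (simp add: closed_segment_subset path_image_join)
  then show ?thesis
    using hull_sub[OF assms(1)] homotopic_paths_subset by blast
qed

section \<open>Climbing edge paths and their uniqueness up to homotopy\<close>

lemma dpath_path:
  assumes "dpath v p"
  shows "v \<in> V" "path p" "path_image p \<subseteq> X" "pathstart p = e b" "pathfinish p = e v"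
proof -
  have "v \<in> V \<and> path p \<and> path_image p \<subseteq> X \<and> pathstart p = e b \<and> pathfinish p = e v"
    using assms
  proof induction
    case base
    then show ?case
      using b_in hull_sub[OF simplex1[OF b_in]]
      by (auto simp: pathstart_def pathfinish_def path_def path_image_def)
  next
    case (step u p v)
    then show ?case
      using edge_in_X by (auto simp: path_image_join)
  qed
  then show "v \<in> V" "path p" "path_image p \<subseteq> X" "pathstart p = e b" "pathfinish p = e v"
    by auto
qed

lemma dpath_exists: "v \<in> V \<Longrightarrow> \<exists>p. dpath v p"
proof (induction "g v" arbitrary: v rule: less_induct)
  case less
  show ?case
  proof (cases "v = b")
    case True
    then show ?thesis using dpath.base by blast
  next
    case False
    then obtain u where "u \<in> V" "{u, v} \<in> E" "g u < g v"
      using lower_ne less.prems by blast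
    then show ?thesis
      using less dpath.step by blast
  qed
qed

text \<open>After reassociation, the trip along the edge and back is a degenerate triangle,
  contracted within the edge.\<close>

lemma join_edge_back:
  assumes "dpath u p" "v \<in> V" "{u, v} \<in> E"
  shows "homotopic_paths X ((p +++ linepath (e u) (e v)) +++ linepath (e v) (e u)) p"
proof -
  note p = dpath_path[OF assms(1)]
  have s: "closed_segment (e u) (e v) \<subseteq> X" "closed_segment (e v) (e u) \<subseteq> X"
    using edge_in_X p(1) assms by (auto simp: closed_segment_commute)
  have "homotopic_paths X ((p +++ linepath (e u) (e v)) +++ linepath (e v) (e u))
          (p +++ (linepath (e u) (e v) +++ linepath (e v) (e u)))"
    using p s by (intro homotopic_paths_sym[OF homotopic_paths_assoc]) auto
  also have "homotopic_paths X \<dots> (p +++ linepath (e u) (e u))"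
    using p s assms
    by (intro homotopic_paths_join homotopic_paths_sym[OF homotopic_triangle[OF simplex2]])
       (auto intro: hull_inc)
  also have "homotopic_paths X \<dots> p"
    using p by (intro homotopic_paths_rid') auto
  finally show ?thesis .
qed

text \<open>Uniqueness at both ends is a hypothesis, so that the lemma can serve inside the
  induction for \<open>dpath_unique\<close>. A climbing edge extends \<open>p\<close> to a
  \<open>dpath\<close>; along a descending one, \<open>p\<close> is homotopic to \<open>q\<close>
  followed by the reversed edge, which then cancels.\<close>

lemma dpath_edge_aux:
  assumes uv: "{u, v} \<in> E" "u \<noteq> v" and p: "dpath u p" and q: "dpath v q"
    and uniq_u: "\<And>p p'. \<lbrakk>dpath u p; dpath u p'\<rbrakk> \<Longrightarrow> homotopic_paths X p p'"
    and uniq_v: "\<And>q q'. \<lbrakk>dpath v q; dpath v q'\<rbrakk> \<Longrightarrow> homotopic_paths X q q'"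
  shows "homotopic_paths X (p +++ linepath (e u) (e v)) q"
proof -
  have V: "u \<in> V" "v \<in> V" using p q dpath_path by auto
  have vu: "{v, u} \<in> E" using uv by (simp add: insert_commute)
  consider "g u < g v" | "g v < g u" using g_neq[OF V uv(2,1)] by linarith
  then show ?thesis
  proof cases
    case 1
    then show ?thesis using dpath.step[OF p V(2) uv(1)] uniq_v q by blast
  next
    case 2
    then have "homotopic_paths X p (q +++ linepath (e v) (e u))"
      using dpath.step[OF q V(1) vu] uniq_u p by blast
    then have "homotopic_paths X (p +++ linepath (e u) (e v))
                 ((q +++ linepath (e v) (e u)) +++ linepath (e u) (e v))"
      using edge_in_X[OF V uv(1)] dpath_path[OF p] by (intro homotopic_paths_join) auto
    then show ?thesis
      using join_edge_back[OF q V(1) vu] homotopic_paths_trans by blast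
  qed
qed

text \<open>The three vertices span a simplex, so the last edge slides across a filled
  triangle.\<close>

lemma dpath_detour:
  assumes "dpath u p" "dpath u' p'" "v \<in> V" "{u, v} \<in> E" "{u', v} \<in> E" "{u, u'} \<in> E"
    and h: "homotopic_paths X (p +++ linepath (e u) (e u')) p'"
  shows "homotopic_paths X (p +++ linepath (e u) (e v)) (p' +++ linepath (e u') (e v))"
proof -
  note p = dpath_path[OF assms(1)] and p' = dpath_path[OF assms(2)]
  have s: "closed_segment (e u) (e v) \<subseteq> X" "closed_segment (e u') (e v) \<subseteq> X"
    "closed_segment (e u) (e u') \<subseteq> X"
    using edge_in_X p(1) p'(1) assms by auto
  have "homotopic_paths X (p +++ linepath (e u) (e v))
          (p +++ (linepath (e u) (e u') +++ linepath (e u') (e v)))"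
    using p p'(1) assms
    by (intro homotopic_paths_join homotopic_triangle[OF simplex3[of u u' v]])
       (auto intro: hull_inc)
  also have "homotopic_paths X \<dots> ((p +++ linepath (e u) (e u')) +++ linepath (e u') (e v))"
    using p s by (intro homotopic_paths_assoc) auto
  also have "homotopic_paths X \<dots> (p' +++ linepath (e u') (e v))"
    using h s p by (intro homotopic_paths_join) auto
  finally show ?thesis .
qed

text \<open>Induction on height: two paths enter \<open>v\<close> through lower neighbours, which a
  chain in the descending link joins; each step of the chain is a detour across a triangle.\<close>

lemma dpath_unique: "\<lbrakk>dpath v p; dpath v p'\<rbrakk> \<Longrightarrow> homotopic_paths X p p'"
proof (induction "g v" arbitrary: v p p' rule: less_induct)
  case less
  have vV: "v \<in> V" using less.prems dpath_path by blast
  show ?case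
  proof (cases "v = b")
    case True
    \<comment> \<open>A last edge into \<open>b\<close> would start strictly below the
      minimum.\<close>
    have "r = linepath (e b) (e b)" if "dpath b r" for r
      using that
    proof cases
      case (step u q)
      then show ?thesis using b_min[of u] dpath_path(1)[of u q] by simp
    qed simp
    with True less.prems show ?thesis
      using dpath_path by (metis homotopic_paths_refl)
  next
    case False
    obtain u1 p1 where 1: "dpath u1 p1" "{u1, v} \<in> E" "g u1 < g v"
      "p = p1 +++ linepath (e u1) (e v)"
      using less.prems(1) False by (auto elim: dpath.cases)
    obtain u2 p2 where 2: "dpath u2 p2" "{u2, v} \<in> E" "g u2 < g v"
      "p' = p2 +++ linepath (e u2) (e v)"
      using less.prems(2) False by (auto elim: dpath.cases)
    have u1V: "u1 \<in> V" and u2V: "u2 \<in> V" using 1 2 dpath_path by auto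
    have chain: "(u1, u2) \<in> {(x, y). x \<in> V \<and> y \<in> V \<and> {x, v} \<in> E \<and> {y, v} \<in> E \<and>
                       g x < g v \<and> g y < g v \<and> {x, y} \<in> E}\<^sup>*"
      using lower_conn[OF vV u1V 1(2,3) u2V 2(2,3)] .
    \<comment> \<open>Quantifying over every \<open>q\<close> makes the choice of paths to the
      intermediate chain vertices immaterial.\<close>
    have "dpath u2 q \<Longrightarrow> homotopic_paths X p (q +++ linepath (e u2) (e v))" for q
      using chain
    proof (induction arbitrary: q rule: rtrancl_induct)
      case base
      have "homotopic_paths X p1 q" using less.hyps[OF 1(3)] 1(1) base by blast
      then show ?case
        unfolding 1(4) using dpath_path[OF 1(1)] edge_in_X[OF u1V vV 1(2)]
        by (intro homotopic_paths_join) auto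
    next
      case (step x y)
      then have xy: "x \<in> V" "y \<in> V" "{x, v} \<in> E" "{y, v} \<in> E" "g x < g v" "g y < g v" "{x, y} \<in> E"
        by auto
      obtain r where r: "dpath x r" using dpath_exists xy(1) by blast
      have "homotopic_paths X p (r +++ linepath (e x) (e v))"
        using step.IH r by blast
      moreover have "homotopic_paths X (r +++ linepath (e x) (e v)) (q +++ linepath (e y) (e v))"
      \<comment> \<open>\<open>E\<close> may contain singletons, so a chain step may stay at its
        vertex.\<close>
      proof (cases "x = y")
        case True
        then have "homotopic_paths X r q" using less.hyps[OF xy(6)] r step.prems by blast
        then show ?thesis
          unfolding True using dpath_path[OF r] edge_in_X[OF xy(2) vV xy(4)] True
          by (intro homotopic_paths_join) auto
      next
        case False
        have "homotopic_paths X (r +++ linepath (e x) (e y)) q"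
          using dpath_edge_aux[OF xy(7) False r step.prems] less.hyps xy by blast
        then show ?thesis
          using dpath_detour[OF r step.prems vV] xy by blast
      qed
      ultimately show ?case using homotopic_paths_trans by blast
    qed
    then show ?thesis using 2 by blast
  qed
qed

section \<open>Open stars and paths from the base vertex to arbitrary points\<close>

lemma star_cover: "y \<in> X \<Longrightarrow> \<exists>v\<in>V. y \<in> star v"
  using carrier[of y] unfolding star_def clique_complex_def by blast

lemma vertex_in_star: "v \<in> V \<Longrightarrow> e v \<in> star v"
  using hull_sub[OF simplex1, of v] c_self by (simp add: star_def)

text \<open>On the segment \<open>c v\<close> interpolates affinely between 1 and a positive value,
  and the segment lies in the carrier simplex of \<open>y\<close>, which contains \<open>v\<close>.
  Hence open stars are starlike.\<close>

lemma star_segment: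
  assumes v: "v \<in> V" and y: "y \<in> star v"
  shows "closed_segment (e v) y \<subseteq> star v"
proof -
  obtain \<sigma> where \<sigma>: "\<sigma> \<in> clique_complex V E" "y \<in> convex hull (e ` \<sigma>)" "v \<in> \<sigma>"
    using carrier[of y] y v unfolding star_def by blast
  have X: "closed_segment (e v) y \<subseteq> X"
    using segment_in_X[OF \<sigma>(1) vertex_in_hull[OF \<sigma>(3)] \<sigma>(2)] .
  interpret bounded_linear "c v" by (rule c_linear[OF v])
  have "c v z > 0" if "z \<in> closed_segment (e v) y" for z
  proof -
    obtain t where t: "0 \<le> t" "t \<le> 1" "z = (1 - t) *\<^sub>R e v + t *\<^sub>R y"
      using \<open>z \<in> closed_segment (e v) y\<close> unfolding in_segment by auto
    have "c v z = (1 - t) + t * c v y"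
      by (simp add: t(3) add scaleR c_self[OF v])
    then show ?thesis
      using t(1,2) y by (cases "t = 0") (auto simp: star_def intro: add_nonneg_pos)
  qed
  then show ?thesis using X by (auto simp: star_def)
qed

lemma star_simply_connected: "v \<in> V \<Longrightarrow> simply_connected (star v)"
  using starlike_imp_simply_connected star_segment vertex_in_star unfolding starlike_def by blast

lemma star_sub: "star v \<subseteq> X"
  by (auto simp: star_def)

text \<open>The tail \<open>q\<close> may be any path in the star, so prolonging it within that star
  yields a \<open>cpath\<close> again.\<close>

definition cpath :: "'b \<Rightarrow> (real \<Rightarrow> 'b) \<Rightarrow> bool" where
  "cpath y r \<longleftrightarrow> (\<exists>v p q. dpath v p \<and> path q \<and> path_image q \<subseteq> star v \<and> pathstart q = e v \<and>
                       pathfinish q = y \<and> r = p +++ q)"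

lemma cpath_path:
  assumes "cpath y r"
  shows "path r" "path_image r \<subseteq> X" "pathstart r = e b" "pathfinish r = y"
proof -
  obtain v p q where r: "dpath v p" "path q" "path_image q \<subseteq> star v" "pathstart q = e v"
    "pathfinish q = y" "r = p +++ q"
    using assms unfolding cpath_def by blast
  note p = dpath_path[OF r(1)]
  show "path r" "path_image r \<subseteq> X" "pathstart r = e b" "pathfinish r = y"
    using p r star_sub[of v] by (auto simp: path_image_join)
qed

lemma cpath_star:
  assumes "v \<in> V" "y \<in> star v" "dpath v p"
  shows "cpath y (p +++ linepath (e v) y)"
  unfolding cpath_def using assms star_segment[OF assms(1,2)]
  by (intro exI[of _ v] exI[of _ p] exI[of _ "linepath (e v) y"]) auto

text \<open>Stars are simply connected, so tails can be straightened (\<open>std\<close>). Two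
  vertices whose stars contain \<open>y\<close> both lie in its carrier simplex, so they are equal
  or adjacent, and the triangle they form with \<open>y\<close> is filled.\<close>

lemma cpath_unique:
  assumes "cpath y r" "cpath y r'"
  shows "homotopic_paths X r r'"
proof -
  have std: "homotopic_paths X (p +++ q) (p +++ linepath (e v) y)"
    if "dpath v p" "path q" "path_image q \<subseteq> star v" "pathstart q = e v" "pathfinish q = y" for v p q
  proof -
    note p = dpath_path[OF that(1)]
    have "y \<in> star v" using that(2,3,5) pathfinish_in_path_image by blast
    then have "homotopic_paths (star v) q (linepath (e v) y)"
      using star_simply_connected[OF p(1)] that star_segment[OF p(1)]
      unfolding simply_connected_eq_homotopic_paths by simp
    then show ?thesis
      using homotopic_paths_subset[OF _ star_sub] p that(4) by (intro homotopic_paths_join) auto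
  qed
  obtain v p q where r: "dpath v p" "path q" "path_image q \<subseteq> star v" "pathstart q = e v"
    "pathfinish q = y" "r = p +++ q"
    using assms(1) unfolding cpath_def by blast
  obtain w p' q' where r': "dpath w p'" "path q'" "path_image q' \<subseteq> star w" "pathstart q' = e w"
    "pathfinish q' = y" "r' = p' +++ q'"
    using assms(2) unfolding cpath_def by blast
  note p = dpath_path[OF r(1)] and p' = dpath_path[OF r'(1)]
  have yv: "y \<in> star v" and yw: "y \<in> star w"
    using r(3,5) r'(3,5) pathfinish_in_path_image by (metis subsetD)+
  have sX: "closed_segment (e v) y \<subseteq> X" "closed_segment (e w) y \<subseteq> X"
    using star_segment p(1) p'(1) yv yw star_sub by blast+
  have "homotopic_paths X (p +++ linepath (e v) y) (p' +++ linepath (e w) y)"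
  proof (cases "v = w")
    case True
    then show ?thesis
      using dpath_unique r(1) r'(1) sX p by (intro homotopic_paths_join) auto
  next
    case False
    obtain \<sigma> where \<sigma>: "\<sigma> \<in> clique_complex V E" "y \<in> convex hull (e ` \<sigma>)" "v \<in> \<sigma>" "w \<in> \<sigma>"
      using carrier[of y] yv yw p(1) p'(1) unfolding star_def by blast
    have vw: "{v, w} \<in> E"
      using \<sigma> False by (auto simp: clique_complex_def clique_def)
    have "homotopic_paths X (p +++ linepath (e v) y) (p +++ (linepath (e v) (e w) +++ linepath (e w) y))"
      using p \<sigma> by (intro homotopic_paths_join homotopic_triangle[OF \<sigma>(1)]) (auto intro: hull_inc)
    also have "homotopic_paths X \<dots> ((p +++ linepath (e v) (e w)) +++ linepath (e w) y)"
      using p sX edge_in_X[OF p(1) p'(1) vw] by (intro homotopic_paths_assoc) auto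
    also have "homotopic_paths X \<dots> (p' +++ linepath (e w) y)"
      using dpath_edge_aux[OF vw False r(1) r'(1)] dpath_unique sX p
      by (intro homotopic_paths_join) auto
    finally show ?thesis .
  qed
  then show ?thesis
    using std[OF r(1-5)] std[OF r'(1-5)] r(6) r'(6) homotopic_paths_sym homotopic_paths_trans
    by metis
qed

lemma cpath_exists: "y \<in> X \<Longrightarrow> \<exists>r. cpath y r"
  using star_cover dpath_exists cpath_star by blast

text \<open>Continuation by connectedness of the unit interval: near each parameter,
  \<open>p\<close> stays in a single open star.\<close>

lemma cpath_extend:
  assumes p: "path p" "path_image p \<subseteq> X" and k: "cpath (pathstart p) k" and t: "t \<in> {0..1}"
  shows "\<exists>r. cpath (p t) r \<and> homotopic_paths X (k +++ subpath 0 t p) r"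
proof (rule connected_induction_simple[where S = "{0..1::real}" and a = 0 and b = t])
  note k' = cpath_path[OF k]
  show "\<exists>r. cpath (p 0) r \<and> homotopic_paths X (k +++ subpath 0 0 p) r"
    using k k' by (intro exI[of _ k]) (auto simp: subpath_refl pathstart_def intro: homotopic_paths_rid')
next
  fix a :: real assume a: "a \<in> {0..1}"
  note k' = cpath_path[OF k]
  have cp: "continuous_on {0..1} p" using p(1) by (simp add: path_def)
  have "p a \<in> X" using p(2) a by (auto simp: path_image_def)
  then obtain v where v: "v \<in> V" "p a \<in> star v" using star_cover by blast
  obtain d where d: "dpath v d" using dpath_exists v by blast
  have "continuous_on {0..1} (\<lambda>t. c v (p t))"
    using bounded_linear.continuous_on[OF c_linear[OF v(1)] cp] .
  moreover have "0 < c v (p a)" using v(2) by (simp add: star_def)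
  ultimately obtain \<delta> where \<delta>: "\<delta> > 0"
    "\<And>s. \<lbrakk>s \<in> {0..1}; dist s a < \<delta>\<rbrakk> \<Longrightarrow> dist (c v (p s)) (c v (p a)) < c v (p a)"
    using a unfolding continuous_on_iff by metis
  \<comment> \<open>\<open>T\<close> is an interval, so a subpath between two of its parameters, in
    either order, stays in the star.\<close>
  define T where "T = {0..1} \<inter> ball a \<delta>"
  have cT: "convex T" unfolding T_def by (intro convex_Int convex_real_interval convex_ball)
  have T_star: "p s \<in> star v" if "s \<in> T" for s
  proof -
    have "dist (c v (p s)) (c v (p a)) < c v (p a)"
      using that \<delta>(2)[of s] by (auto simp: T_def dist_commute)
    then have "c v (p s) > 0" by (auto simp: dist_real_def)
    then show ?thesis using that p(2) by (auto simp: star_def T_def path_image_def)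
  qed
  show "\<exists>T. openin (top_of_set {0..1}) T \<and> a \<in> T \<and>
          (\<forall>x\<in>T. \<forall>y\<in>T. (\<exists>r. cpath (p x) r \<and> homotopic_paths X (k +++ subpath 0 x p) r) \<longrightarrow>
                      (\<exists>r. cpath (p y) r \<and> homotopic_paths X (k +++ subpath 0 y p) r))"
  proof (intro exI[of _ T] conjI ballI impI)
    show "openin (top_of_set {0..1}) T" unfolding T_def by (simp add: openin_open_Int)
    show "a \<in> T" using a \<delta> by (simp add: T_def)
    fix x y assume x: "x \<in> T" and y: "y \<in> T"
      and "\<exists>r. cpath (p x) r \<and> homotopic_paths X (k +++ subpath 0 x p) r"
    then obtain r where r: "cpath (p x) r" "homotopic_paths X (k +++ subpath 0 x p) r" by blast
    have xy: "x \<in> {0..1}" "y \<in> {0..1}" using x y by (auto simp: T_def)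
    define l where "l = linepath (e v) (p x)"
    define q where "q = subpath x y p"
    have l: "path l" "path_image l \<subseteq> star v" "pathstart l = e v" "pathfinish l = p x"
      using star_segment[OF v(1) T_star[OF x]] by (auto simp: l_def)
    have "closed_segment x y \<subseteq> T" using closed_segment_subset[OF x y cT] .
    then have q: "path q" "path_image q \<subseteq> star v" "pathstart q = p x" "pathfinish q = p y"
      using xy p T_star by (auto simp: q_def path_image_subpath_gen)
    have lqX: "path_image l \<subseteq> X" "path_image q \<subseteq> X"
      using l(2) q(2) star_sub by blast+
    have sub: "path (subpath 0 s p)" "path_image (subpath 0 s p) \<subseteq> X" if "s \<in> {0..1}" for s
      using that p path_image_subpath_subset[of 0 s p] by auto
    have k0: "pathfinish k = p 0" using k' by (simp add: pathstart_def)
    note dp = dpath_path[OF d]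
    \<comment> \<open>\<open>r\<close> may arrive through another star; uniqueness exchanges it for
      a path through \<open>v\<close>.\<close>
    have r': "homotopic_paths X r (d +++ l)"
      using cpath_unique[OF r(1) cpath_star[OF v(1) T_star[OF x] d]] by (simp add: l_def)
    have "homotopic_paths X (k +++ subpath 0 y p) (k +++ (subpath 0 x p +++ q))"
      unfolding q_def using k' k0 xy p
      by (intro homotopic_paths_join homotopic_paths_sym[OF homotopic_join_subpaths]) auto
    also have "homotopic_paths X \<dots> ((k +++ subpath 0 x p) +++ q)"
      using k' k0 sub[OF xy(1)] q lqX by (intro homotopic_paths_assoc) auto
    also have "homotopic_paths X \<dots> ((d +++ l) +++ q)"
      using homotopic_paths_trans[OF r(2) r'] q lqX k0 by - (rule homotopic_paths_join, auto)
    also have "homotopic_paths X \<dots> (d +++ (l +++ q))"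
      using dp l q lqX by (intro homotopic_paths_sym[OF homotopic_paths_assoc]) auto
    finally have "homotopic_paths X (k +++ subpath 0 y p) (d +++ (l +++ q))" .
    moreover have "cpath (p y) (d +++ (l +++ q))"
      unfolding cpath_def using d l q
      by (intro exI[of _ v] exI[of _ d] exI[of _ "l +++ q"]) (auto simp: path_image_join)
    ultimately show "\<exists>r. cpath (p y) r \<and> homotopic_paths X (k +++ subpath 0 y p) r" by blast
  qed
qed (use t in auto)

lemma simply_connected_X: "simply_connected X"
  unfolding simply_connected_eq_contractible_path
proof (intro conjI allI impI)
  have conn: "path_component X (e b) y" if "y \<in> X" for y
    using cpath_exists[OF that] cpath_path unfolding path_component_def by blast
  then show "path_connected X"
    unfolding path_connected_component by (meson path_component_sym path_component_trans)
next
  fix p assume "path p \<and> path_image p \<subseteq> X \<and> pathfinish p = pathstart p"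
  then have p: "path p" "path_image p \<subseteq> X" "pathfinish p = pathstart p" by auto
  obtain k where k: "cpath (pathstart p) k"
    using cpath_exists p pathstart_in_path_image by blast
  note k' = cpath_path[OF k]
  obtain r where r: "cpath (p 1) r" "homotopic_paths X (k +++ subpath 0 1 p) r"
    using cpath_extend[OF p(1,2) k, of 1] by auto
  \<comment> \<open>The loop is closed, so \<open>r\<close> and \<open>k\<close> end at the same
    point and are homotopic.\<close>
  have kp: "homotopic_paths X (k +++ p) k"
    using cpath_unique[of "p 1" r k] r k p(3) homotopic_paths_trans
    by (metis pathfinish_def subpath_trivial)
  \<comment> \<open>Insert \<open>reversepath k +++ k\<close>, absorb the loop into
    \<open>k\<close>, and cancel.\<close>
  have "homotopic_paths X p (linepath (pathstart p) (pathstart p) +++ p)"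
    using p by (intro homotopic_paths_sym[OF homotopic_paths_lid]) auto
  also have "homotopic_paths X \<dots> ((reversepath k +++ k) +++ p)"
    using homotopic_paths_linv[OF k'(1,2)] k' p
    by (intro homotopic_paths_join) (auto intro: homotopic_paths_sym)
  also have "homotopic_paths X \<dots> (reversepath k +++ (k +++ p))"
    using k' p by (intro homotopic_paths_sym[OF homotopic_paths_assoc]) auto
  also have "homotopic_paths X \<dots> (reversepath k +++ k)"
    using kp k' p by (intro homotopic_paths_join) auto
  also have "homotopic_paths X \<dots> (linepath (pathstart p) (pathstart p))"
    using homotopic_paths_linv[OF k'(1,2)] k' by simp
  finally show "homotopic_paths X p (linepath (pathstart p) (pathstart p))" .
qed

end

section \<open>Coordinates on bounded sequences\<close>

lemma bounded_linear_apply_bcontfun: "bounded_linear (\<lambda>f. apply_bcontfun f x)"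
  by (rule bounded_linear_intro[where K = 1]) (simp_all add: norm_bounded)

text \<open>The standard basis vector; its continuity is automatic because the index type is
  discrete.\<close>

definition unit_bcontfun :: "nat \<Rightarrow> nat \<Rightarrow>\<^sub>C real" where
  "unit_bcontfun k = Bcontfun (\<lambda>m. if m = k then 1 else 0)"

lemma apply_unit_bcontfun: "apply_bcontfun (unit_bcontfun k) m = (if m = k then 1 else 0)"
proof -
  have "(\<lambda>m::nat. if m = k then 1 else 0::real) \<in> bcontfun"
    by (rule bcontfun_normI[where b = 1]) (auto simp: continuous_on_discrete)
  then show ?thesis by (simp add: unit_bcontfun_def Bcontfun_inverse)
qed

context morse_graph
begin

text \<open>The library develops the group laws of path homotopy through \<open>linepath\<close>, which needs a
  normed space; hence the realization is moved into a space of bounded functions first.\<close>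

theorem simply_connected_geometric_realization:
  assumes V: "finite V"
  shows "simply_connected (geometric_realization (clique_complex V E))"
proof -
  obtain ix :: "'a \<Rightarrow> nat" where ix: "inj_on ix V"
    using finite_imp_inj_to_nat_seg[OF V] by blast
  \<comment> \<open>Vertices go to distinct basis vectors, \<open>c\<close> reads off coordinates,
    and \<open>R\<close> extends \<open>e\<close> affinely over the realization.\<close>
  define e where "e v = unit_bcontfun (ix v)" for v
  define c where "c v y = apply_bcontfun y (ix v)" for v :: 'a and y :: "nat \<Rightarrow>\<^sub>C real"
  define R where "R f = (\<Sum>v\<in>V. f v *\<^sub>R e v)" for f :: "'a \<Rightarrow> real"
  define G where "G = geometric_realization (clique_complex V E)"
  have c_lin: "bounded_linear (c v)" for v
    unfolding c_def by (rule bounded_linear_apply_bcontfun)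
  have c_e: "c v (e w) = (if v = w then 1 else 0)" if "v \<in> V" "w \<in> V" for v w
    using that ix by (auto simp: c_def e_def apply_unit_bcontfun inj_on_def)
  have c_R: "c v (R f) = f v" if v: "v \<in> V" for v f
  proof -
    interpret bounded_linear "c v" by (rule c_lin)
    have "c v (R f) = (\<Sum>w\<in>V. if v = w then f w else 0)"
      unfolding R_def sum by (rule sum.cong) (auto simp: scaleR c_e v)
    then show ?thesis using V v by simp
  qed
  have G_iff: "f \<in> G \<longleftrightarrow> (\<forall>v. 0 \<le> f v) \<and> {v. f v \<noteq> 0} \<in> clique_complex V E \<and> (\<Sum>v | f v \<noteq> 0. f v) = 1" for f
    by (simp add: G_def geometric_realization_def)
  have hull: "convex hull (e ` \<sigma>) \<subseteq> R ` G" if \<sigma>: "\<sigma> \<in> clique_complex V E" for \<sigma>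
  proof
    have \<sigma>V: "finite \<sigma>" "\<sigma> \<subseteq> V" "clique \<sigma> E" using \<sigma> by (auto simp: clique_complex_def)
    have inj: "inj_on e \<sigma>"
      using c_e \<sigma>V(2) by (metis inj_onI subsetD zero_neq_one)
    fix y assume "y \<in> convex hull (e ` \<sigma>)"
    then obtain u where u: "\<forall>x\<in>e ` \<sigma>. 0 \<le> u x" "sum u (e ` \<sigma>) = 1" "(\<Sum>x\<in>e ` \<sigma>. u x *\<^sub>R x) = y"
      using \<sigma>V(1) by (auto simp: convex_hull_finite)
    define f where "f v = (if v \<in> \<sigma> then u (e v) else 0)" for v
    \<comment> \<open>Weights may vanish, so the support can be a proper face of \<sigma>; it is
      nonempty since the weights sum to 1.\<close>
    have sub: "{v. f v \<noteq> 0} \<subseteq> \<sigma>" by (auto simp: f_def)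
    have "sum u (e ` \<sigma>) = sum f \<sigma>"
      unfolding sum.reindex[OF inj] by (rule sum.cong) (auto simp: f_def)
    then have s1: "(\<Sum>v | f v \<noteq> 0. f v) = 1"
      using u(2) sum.mono_neutral_left[OF \<sigma>V(1) sub, of f] by auto
    then have "{v. f v \<noteq> 0} \<noteq> {}" by fastforce
    then have "{v. f v \<noteq> 0} \<in> clique_complex V E"
      using sub \<sigma>V smaller_clique finite_subset unfolding clique_complex_def by blast
    then have "f \<in> G" using s1 u(1) by (auto simp: G_iff f_def)
    moreover have "R f = y"
    proof -
      have "R f = (\<Sum>v\<in>\<sigma>. f v *\<^sub>R e v)"
        unfolding R_def by (rule sum.mono_neutral_right) (use V \<sigma>V f_def in auto)
      also have "\<dots> = y"
        unfolding u(3)[symmetric] sum.reindex[OF inj] by (rule sum.cong) (auto simp: f_def)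
      finally show ?thesis .
    qed
    ultimately show "y \<in> R ` G" by blast
  qed
  have carrier: "\<exists>\<sigma> \<in> clique_complex V E. y \<in> convex hull (e ` \<sigma>) \<and> (\<forall>v\<in>V. c v y > 0 \<longleftrightarrow> v \<in> \<sigma>)"
    if y: "y \<in> R ` G" for y
  proof -
    obtain f where f: "f \<in> G" "y = R f" using y by blast
    define \<sigma> where "\<sigma> = {v. f v \<noteq> 0}"
    have \<sigma>: "\<sigma> \<in> clique_complex V E" "sum f \<sigma> = 1" "\<And>v. 0 \<le> f v"
      using f(1) by (auto simp: G_iff \<sigma>_def)
    have \<sigma>V: "finite \<sigma>" "\<sigma> \<subseteq> V" using \<sigma> by (auto simp: clique_complex_def)
    have "y = (\<Sum>v\<in>\<sigma>. f v *\<^sub>R e v)"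
      unfolding f(2) R_def by (rule sum.mono_neutral_right) (use V \<sigma>V \<sigma>_def in auto)
    also have "\<dots> \<in> convex hull (e ` \<sigma>)"
      by (rule convex_sum) (use \<sigma> \<sigma>V in \<open>auto intro: hull_inc\<close>)
    finally have "y \<in> convex hull (e ` \<sigma>)" .
    moreover have "c v y > 0 \<longleftrightarrow> v \<in> \<sigma>" if "v \<in> V" for v
      using that \<sigma>(3)[of v] by (auto simp: f(2) c_R \<sigma>_def)
    ultimately show ?thesis using \<sigma>(1) by blast
  qed
  interpret realized_morse_graph V E g b e c "R ` G"
    by (intro realized_morse_graph.intro realized_morse_graph_axioms.intro morse_graph_axioms)
       (use c_lin c_e hull carrier in auto)
  \<comment> \<open>\<open>h\<close> recovers the barycentric coordinates; its default 0 is right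
    because points of \<open>G\<close> are supported in \<open>V\<close>. Thus \<open>h\<close> is a
    left inverse of \<open>R\<close> on \<open>G\<close>, and \<open>G\<close> is a retract of the
    image of \<open>R\<close>.\<close>
  define h where "h y = (\<lambda>v. if v \<in> V then c v y else 0)" for y
  have hR: "h (R f) = f" if "f \<in> G" for f
  proof
    fix v
    have "f v = 0" if "v \<notin> V" using that \<open>f \<in> G\<close> by (auto simp: G_iff clique_complex_def)
    then show "h (R f) v = f v" by (auto simp: h_def c_R)
  qed
  have ch: "continuous_on (R ` G) h"
  proof (rule continuous_on_coordinatewise_then_product)
    show "continuous_on (R ` G) (\<lambda>y. h y v)" for v
      unfolding h_def by (cases "v \<in> V") (auto intro: linear_continuous_on c_lin)
  qed
  have cR: "continuous_on G R"
    unfolding R_def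
    by (intro continuous_intros continuous_on_product_then_coordinatewise continuous_on_id)
  have "simply_connected G"
    by (rule simply_connected_retraction_gen[OF simply_connected_X ch _ cR])
       (auto simp: hR image_image)
  then show ?thesis by (simp add: G_def)
qed

end

section \<open>The partition graph\<close>

text \<open>Allowing parts 0 in the multiset makes the move to a new row a move to an ordinary part.\<close>

definition parts_of :: "nat multiset \<Rightarrow> nat list" where
  "parts_of M = rev (sorted_list_of_multiset (filter_mset (\<lambda>k. k \<noteq> 0) M))"

definition sq_sum :: "nat list \<Rightarrow> nat" where
  "sq_sum xs = (\<Sum>x\<leftarrow>xs. x\<^sup>2)"

lemma sum_list_filter_mset_nonzero:
  fixes f :: "nat \<Rightarrow> nat"
  shows "f 0 = 0 \<Longrightarrow> (\<Sum>x\<in>#filter_mset (\<lambda>k. k \<noteq> 0) M. f x) = (\<Sum>x\<in>#M. f x)"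
  by (induction M) auto

lemma mset_parts_of [simp]: "mset (parts_of M) = filter_mset (\<lambda>k. k \<noteq> 0) M"
  by (simp add: parts_of_def)

lemma sum_list_parts_of [simp]: "sum_list (parts_of M) = \<Sum>\<^sub># M"
  using sum_list_filter_mset_nonzero[of "\<lambda>x. x" M] by (simp flip: sum_mset_sum_list)

lemma sq_sum_parts_of: "sq_sum (parts_of M) = (\<Sum>x\<in>#M. x\<^sup>2)"
  using sum_list_filter_mset_nonzero[of "\<lambda>x. x\<^sup>2" M]
  by (simp add: sq_sum_def flip: sum_mset_sum_list)

lemma parts_of_in_partitions: "parts_of M \<in> partitions n \<longleftrightarrow> \<Sum>\<^sub># M = n"
proof -
  have "0 \<notin># mset (parts_of M)" by simp
  then have "0 \<notin> set (parts_of M)" by (metis set_mset_mset)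
  moreover have "sorted_wrt (\<ge>) (parts_of M)"
    by (simp add: parts_of_def sorted_wrt_rev)
  ultimately show ?thesis by (simp add: partitions_def)
qed

lemma parts_of_mset:
  assumes "xs \<in> partitions n"
  shows "parts_of (mset xs) = xs"
proof -
  have "filter_mset (\<lambda>k. k \<noteq> 0) (mset xs) = mset xs"
    using assms by (metis (mono_tags, lifting) filter_True mem_Collect_eq mset_filter partitions_def)
  moreover have "sort xs = rev xs"
    using assms by (intro properties_for_sort) (simp_all add: partitions_def sorted_wrt_rev)
  ultimately show ?thesis
    by (simp add: parts_of_def flip: mset_filter)
qed

lemma parts_of_add_zero [simp]: "parts_of (add_mset 0 M) = parts_of M"
  by (simp add: parts_of_def)

lemma parts_of_eq_iff:
  "parts_of M = parts_of N \<longleftrightarrow> filter_mset (\<lambda>k. k \<noteq> 0) M = filter_mset (\<lambda>k. k \<noteq> 0) N"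
  by (metis mset_parts_of parts_of_def)

text \<open>From \<open>x^2 + s^2 <= (x + s)^2\<close>. It ensures that subtracting the sum of
  squares from \<open>n^2\<close> is never cut off at 0.\<close>

lemma sq_sum_le: "sq_sum xs \<le> (sum_list xs)\<^sup>2"
proof (induction xs)
  case (Cons x xs)
  then show ?case by (simp add: sq_sum_def power2_sum)
qed (simp add: sq_sum_def)

section \<open>Cell moves as exchanges between two parts\<close>

lemma move_cell_eq:
  assumes "i < length xs" "j \<le> length xs" "i \<noteq> j"
  shows "move_cell xs i j = parts_of (mset ((xs @ [0])[i := (xs @ [0]) ! i - 1, j := (xs @ [0]) ! j + 1]))"
  by (simp add: move_cell_def parts_of_def Let_def flip: mset_filter)

lemma mset_update2:
  fixes ys :: "nat list"
  assumes "i < length ys" "j < length ys" "i \<noteq> j"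
  shows "\<exists>N. mset ys = N + {#ys ! i, ys ! j#} \<and> mset (ys[i := x, j := y]) = N + {#x, y#}"
proof -
  have i: "ys ! i \<in># mset ys" using assms by simp
  define L where "L = mset ys - {#ys ! i#}"
  have L: "mset ys = add_mset (ys ! i) L" using i by (simp add: L_def)
  have u: "mset (ys[i := x]) = add_mset x L" using assms by (simp add: mset_update L_def)
  have j: "ys ! j \<in># L"
  proof -
    \<comment> \<open>The entries at \<open>i\<close> and \<open>j\<close> may be equal. Overwriting
      entry \<open>i\<close> by a value other than \<open>ys ! j\<close> shows that the occurrence
      at \<open>j\<close> survives in \<open>L\<close>.\<close>
    have "ys[i := Suc (ys ! j)] ! j \<in># mset (ys[i := Suc (ys ! j)])"
      using assms by (metis in_multiset_in_set length_list_update nth_mem)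
    then show ?thesis using assms by (simp add: mset_update L_def)
  qed
  define N where "N = L - {#ys ! j#}"
  have N: "L = add_mset (ys ! j) N" using j by (simp add: N_def)
  have "mset (ys[i := x, j := y]) = add_mset y (mset (ys[i := x]) - {#ys ! j#})"
    using assms by (simp add: mset_update)
  also have "\<dots> = N + {#x, y#}" by (simp add: u N)
  finally show ?thesis using L N by (intro exI[of _ N]) simp
qed

text \<open>The appended row is covered by \<open>b = 0\<close>, and the donor row is positive,
  hence a successor.\<close>

lemma cell_moveE:
  assumes "cell_move xs ys" "xs \<in> partitions n"
  obtains N a b where "xs = parts_of (N + {#Suc a, b#})" "ys = parts_of (N + {#a, Suc b#})"
proof -
  obtain i j where ij: "i < length xs" "j \<le> length xs" "i \<noteq> j" "ys = move_cell xs i j"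
    using assms(1) by (auto simp: cell_move_def)
  let ?z = "xs @ [0]"
  obtain N where N: "mset ?z = N + {#?z ! i, ?z ! j#}"
    "mset (?z[i := ?z ! i - 1, j := ?z ! j + 1]) = N + {#?z ! i - 1, ?z ! j + 1#}"
    using mset_update2[of i ?z j] ij by auto
  have "xs = parts_of (N + {#?z ! i, ?z ! j#})"
    unfolding N(1)[symmetric] using parts_of_mset[OF assms(2)] by simp
  moreover have "?z ! i \<noteq> 0"
    using assms(2) nth_mem[OF ij(1)] ij(1) unfolding partitions_def nth_append by (metis (mono_tags, lifting) mem_Collect_eq)
  ultimately show ?thesis
    using that[of N "?z ! i - 1" "?z ! j"] N move_cell_eq[OF ij(1-3)] ij(4) by simp
qed

lemma cell_move_parts_of:
  "cell_move (parts_of (N + {#Suc a, b#})) (parts_of (N + {#a, Suc b#}))"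
proof -
  define xs where "xs = parts_of (N + {#Suc a, b#})"
  define F where "F = filter_mset (\<lambda>k. k \<noteq> (0::nat))"
  have ms: "mset xs = F N + {#Suc a#} + F {#b#}" by (simp add: xs_def F_def)
  \<comment> \<open>If \<open>b = 0\<close>, the appended row is the recipient itself; otherwise it
    is one more idle row.\<close>
  define L where "L = F N + (if b = 0 then {#} else {#0#})"
  have z: "mset (xs @ [0]) = L + {#Suc a, b#}"
    by (auto simp: ms F_def L_def)
  have "Suc a \<in> set (xs @ [0])" using z by (metis set_mset_mset union_iff add_mset_add_single insert_iff set_mset_add_mset_insert)
  then obtain l1 l2 where l: "xs @ [0] = l1 @ Suc a # l2" by (meson split_list)
  then have "mset (l1 @ l2) = add_mset b L" using z by simp
  then have "b \<in> set (l1 @ l2)" by (metis set_mset_mset union_single_eq_member)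
  then obtain k where k: "k < length (l1 @ l2)" "(l1 @ l2) ! k = b"
    by (metis in_set_conv_nth)
  define i where "i = length l1"
  \<comment> \<open>\<open>k\<close> counts positions with the donor row left out, so indices from
    the donor on shift by one.\<close>
  define j where "j = (if k < length l1 then k else Suc k)"
  have i: "(xs @ [0]) ! i = Suc a" "i < length (xs @ [0])" by (auto simp: l i_def)
  have j: "(xs @ [0]) ! j = b" "j < length (xs @ [0])" "i \<noteq> j"
    using k by (auto simp: l i_def j_def nth_append Suc_diff_le)
  have ix: "i < length xs" using i by (auto simp: nth_append split: if_splits)
  obtain N' where N': "mset (xs @ [0]) = N' + {#Suc a, b#}"
    "mset ((xs @ [0])[i := a, j := Suc b]) = N' + {#a, Suc b#}"
    using mset_update2[OF i(2) j(2,3), of a "Suc b"] i j by auto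
  have "N' = L" using N'(1) z by simp
  then have "move_cell xs i j = parts_of (L + {#a, Suc b#})"
    using move_cell_eq[OF ix _ j(3)] i j N'(2) by simp
  also have "\<dots> = parts_of (N + {#a, Suc b#})"
    by (simp add: parts_of_eq_iff L_def F_def filter_filter_mset)
  finally show ?thesis
    unfolding cell_move_def xs_def[symmetric] using ix j by (intro exI[of _ i] exI[of _ j]) auto
qed

text \<open>The move may go either way along the edge, hence the unordered pair;
  \<open>a = b\<close> would only swap the two parts.\<close>

lemma partition_edge_cases:
  assumes "{u, v} \<in> partition_graph_edges n"
  obtains N a b where "{u, v} = {parts_of (N + {#Suc a, b#}), parts_of (N + {#a, Suc b#})}" "a \<noteq> b"
proof -
  obtain xs ys where xy: "{u, v} = {xs, ys}" "xs \<in> partitions n" "ys \<in> partitions n" "xs \<noteq> ys"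
    "cell_move xs ys \<or> cell_move ys xs"
    using assms by (auto simp: partition_graph_edges_def)
  obtain xs ys where xy: "{u, v} = {xs, ys}" "xs \<in> partitions n" "xs \<noteq> ys" "cell_move xs ys"
    using xy(5) xy(1-4) by (metis insert_commute)
  obtain N a b where N: "xs = parts_of (N + {#Suc a, b#})" "ys = parts_of (N + {#a, Suc b#})"
    using cell_moveE[OF xy(4,2)] .
  have "a \<noteq> b" using xy(3) N by (auto simp: add_mset_commute)
  then show ?thesis using that[of N a b] xy(1) N by blast
qed

text \<open>The two sums differ by \<open>2 * (b - a)\<close>.\<close>

lemma sq_sum_move:
  assumes "a < b"
  shows "sq_sum (parts_of (N + {#Suc a, b#})) < sq_sum (parts_of (N + {#a, Suc b#}))"
  using assms by (simp add: sq_sum_parts_of power2_eq_square)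

lemma sq_sum_edge_neq:
  assumes "{u, v} \<in> partition_graph_edges n"
  shows "sq_sum u \<noteq> sq_sum v"
proof -
  obtain N a b where N: "{u, v} = {parts_of (N + {#Suc a, b#}), parts_of (N + {#a, Suc b#})}" "a \<noteq> b"
    using partition_edge_cases[OF assms] .
  have "sq_sum (parts_of (N + {#Suc a, b#})) \<noteq> sq_sum (parts_of (N + {#a, Suc b#}))"
    using sq_sum_move[of a b N] sq_sum_move[of b a N] N(2)
    by (cases a b rule: linorder_cases) (simp_all add: add_mset_commute)
  with N(1) show ?thesis by (auto simp: doubleton_eq_iff)
qed

lemma move_edge:
  assumes "\<Sum>\<^sub># N + a + b + 1 = n"
    and "parts_of (N + {#Suc a, b#}) \<noteq> parts_of (N + {#a, Suc b#})"
  shows "{parts_of (N + {#Suc a, b#}), parts_of (N + {#a, Suc b#})} \<in> partition_graph_edges n"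
  unfolding partition_graph_edges_def
  using assms cell_move_parts_of[of N a b]
  by (intro CollectI exI[of _ "parts_of (N + {#Suc a, b#})"] exI[of _ "parts_of (N + {#a, Suc b#})"])
     (simp add: parts_of_in_partitions)

section \<open>Neighbours with larger sum of squares\<close>

lemma sum_mset_partition: "v \<in> partitions n \<Longrightarrow> \<Sum>\<^sub># (mset v) = n"
  by (simp add: partitions_def sum_mset_sum_list)

text \<open>By \<open>sq_sum_move\<close>, the sum grows exactly when the recipient \<open>a\<close>
  is at least as long as the donor \<open>Suc b\<close>.\<close>

lemma ascending_edge_iff:
  assumes v: "v \<in> partitions n"
  shows "{u, v} \<in> partition_graph_edges n \<and> sq_sum v < sq_sum u \<longleftrightarrow>
    (\<exists>F a b. b < a \<and> mset v = F + {#a, Suc b#} \<and> u = parts_of (F + {#Suc a, b#}))"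
    (is "?L \<longleftrightarrow> ?R")
proof
  assume L: ?L
  obtain N a b where N: "{u, v} = {parts_of (N + {#Suc a, b#}), parts_of (N + {#a, Suc b#})}" "a \<noteq> b"
    using partition_edge_cases L by blast
  have "\<exists>N a b. b < a \<and> v = parts_of (N + {#a, Suc b#}) \<and> u = parts_of (N + {#Suc a, b#})"
  proof (cases "a < b")
    case True
    have "u = parts_of (N + {#a, Suc b#}) \<and> v = parts_of (N + {#Suc a, b#})"
      using sq_sum_move[OF True, of N] N(1) L by (auto simp: doubleton_eq_iff)
    then show ?thesis
      using True by (intro exI[of _ N] exI[of _ b] exI[of _ a]) (simp add: add_mset_commute)
  next
    case False
    then have "b < a" using N(2) by simp
    moreover have "v = parts_of (N + {#a, Suc b#}) \<and> u = parts_of (N + {#Suc a, b#})"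
      using sq_sum_move[OF \<open>b < a\<close>, of N] N(1) L by (auto simp: doubleton_eq_iff add_mset_commute)
    ultimately show ?thesis by blast
  qed
  then obtain N a b where N: "b < a" "v = parts_of (N + {#a, Suc b#})" "u = parts_of (N + {#Suc a, b#})"
    by blast
  \<comment> \<open>Since \<open>b < a\<close>, both \<open>a\<close> and \<open>Suc b\<close> are
    positive, so discarding zeros affects only \<open>N\<close>.\<close>
  then show ?R
    by (intro exI[of _ "filter_mset (\<lambda>k. k \<noteq> 0) N"] exI[of _ a] exI[of _ b])
       (auto simp: parts_of_eq_iff filter_filter_mset)
next
  assume ?R
  then obtain F a b where F: "b < a" "mset v = F + {#a, Suc b#}" "u = parts_of (F + {#Suc a, b#})"
    by blast
  have v': "v = parts_of (F + {#a, Suc b#})"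
    using parts_of_mset[OF v] F(2) by simp
  have lt: "sq_sum v < sq_sum u"
    using sq_sum_move[OF F(1), of F] by (simp add: v' F(3) add_mset_commute)
  moreover have "\<Sum>\<^sub># F + a + b + 1 = n"
    using sum_mset_partition[OF v] by (simp add: F(2))
  moreover have "u \<noteq> v" using lt by blast
  ultimately show ?L
    using move_edge[of F a b n] by (simp add: v' F(3))
qed

text \<open>Two ascending neighbours that differ only in the recipient, or only in the donor, are
  equal or related by one cell move. So first switch the recipient to a longest row, then switch the
  donor.\<close>

lemma ascending_link_connected:
  assumes v: "v \<in> partitions n"
    and u: "{u, v} \<in> partition_graph_edges n" "sq_sum v < sq_sum u"
    and u': "{u', v} \<in> partition_graph_edges n" "sq_sum v < sq_sum u'"
  shows "(u, u') \<in> {(x, y). {x, v} \<in> partition_graph_edges n \<and> sq_sum v < sq_sum x \<and>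
                     {y, v} \<in> partition_graph_edges n \<and> sq_sum v < sq_sum y \<and>
                     {x, y} \<in> partition_graph_edges n}\<^sup>*"
proof -
  define D where "D = {x. {x, v} \<in> partition_graph_edges n \<and> sq_sum v < sq_sum x}"
  define R where "R = {(x, y). x \<in> D \<and> y \<in> D \<and> {x, y} \<in> partition_graph_edges n}"
  define m where "m = Max (set v)"
  have D_iff: "x \<in> D \<longleftrightarrow>
      (\<exists>F a b. b < a \<and> mset v = F + {#a, Suc b#} \<and> x = parts_of (F + {#Suc a, b#}))" for x
    unfolding D_def using ascending_edge_iff[OF v] by simp
  have le_m: "k \<le> m" if "k \<in># mset v" for k
    using that by (simp add: m_def)
  have sum_v: "\<Sum>\<^sub># (mset v) = n" using v by (rule sum_mset_partition)
  have R_move: "(parts_of (K + {#Suc a, b#}), parts_of (K + {#a, Suc b#})) \<in> R\<^sup>*"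
    if "parts_of (K + {#Suc a, b#}) \<in> D" "parts_of (K + {#a, Suc b#}) \<in> D" "\<Sum>\<^sub># K + a + b + 1 = n"
    for K a b
    using that move_edge[of K a b n] by (cases "parts_of (K + {#Suc a, b#}) = parts_of (K + {#a, Suc b#})")
      (auto simp: R_def)
  have R_sym: "(x, y) \<in> R\<^sup>* \<Longrightarrow> (y, x) \<in> R\<^sup>*" for x y
    by (rule symD[OF sym_rtrancl]) (auto simp: sym_def R_def insert_commute)
  have to_hub: "\<exists>F c. c < m \<and> mset v = F + {#m, Suc c#} \<and> (x, parts_of (F + {#Suc m, c#})) \<in> R\<^sup>*"
    if x: "x \<in> D" for x
  proof -
    obtain F a b where F: "b < a" "mset v = F + {#a, Suc b#}" "x = parts_of (F + {#Suc a, b#})"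
      using x D_iff by blast
    have am: "a \<le> m" by (rule le_m) (simp add: F(2))
    show ?thesis
    proof (cases "a = m")
      case True
      then show ?thesis using F by blast
    next
      case False
      have "set v \<noteq> {}" using F(2) by auto
      then have "m \<in># mset v" by (simp add: m_def)
      \<comment> \<open>As \<open>Suc b <= a < m\<close>, a longest row is neither donor nor
        recipient.\<close>
      then have "m \<in># F" using F False am by auto
      then obtain L where L: "F = add_mset m L" by (meson mset_add)
      define F' where "F' = add_mset a L"
      have v': "mset v = F' + {#m, Suc b#}" by (simp add: F(2) L F'_def add_mset_commute)
      define y where "y = parts_of (F' + {#Suc m, b#})"
      have "y \<in> D" unfolding D_iff y_def using v' less_le_trans[OF F(1) am] by blast
      moreover have y: "y = parts_of (add_mset b L + {#Suc m, a#})"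
        \<comment> \<open>Regrouping shows that \<open>x\<close> and \<open>y\<close> differ by one
          cell moved between the rows \<open>m\<close> and \<open>a\<close>.\<close>
        by (simp add: y_def F'_def add_mset_commute)
      moreover have x': "x = parts_of (add_mset b L + {#m, Suc a#})"
        by (simp add: F(3) L add_mset_commute)
      moreover have "\<Sum>\<^sub># (add_mset b L) + m + a + 1 = n"
        using sum_v by (simp add: F(2) L)
      ultimately have "(x, y) \<in> R\<^sup>*"
        using R_move[of "add_mset b L" m a] x R_sym by simp
      then show ?thesis
        using v' less_le_trans[OF F(1) am] unfolding y_def by blast
    qed
  qed
  obtain F c where F: "c < m" "mset v = F + {#m, Suc c#}" "(u, parts_of (F + {#Suc m, c#})) \<in> R\<^sup>*"
    using to_hub[of u] u by (auto simp: D_def)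
  obtain F' c' where F': "c' < m" "mset v = F' + {#m, Suc c'#}" "(u', parts_of (F' + {#Suc m, c'#})) \<in> R\<^sup>*"
    using to_hub[of u'] u' by (auto simp: D_def)
  have "(parts_of (F + {#Suc m, c#}), parts_of (F' + {#Suc m, c'#})) \<in> R\<^sup>*"
  proof (cases "c = c'")
    case True
    then have "F = F'" using F(2) F'(2) by simp
    then show ?thesis using True by simp
  next
    case False
    \<comment> \<open>With the same recipient and different donors, each remainder contains the
      other donor; one move between the donor rows joins the two neighbours.\<close>
    have eq: "add_mset (Suc c) F = add_mset (Suc c') F'" using F(2) F'(2) by (simp add: add_mset_commute)
    then obtain L where L: "F = add_mset (Suc c') L" "F' = add_mset (Suc c) L"
      using False by (auto simp: add_eq_conv_ex)
    have "parts_of (F + {#Suc m, c#}) \<in> D" "parts_of (F' + {#Suc m, c'#}) \<in> D"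
      using F F' D_iff by blast+
    moreover have "\<Sum>\<^sub># (add_mset (Suc m) L) + c' + c + 1 = n"
      using sum_v by (simp add: F(2) L)
    ultimately show ?thesis
      using R_move[of "add_mset (Suc m) L" c' c] by (simp add: L add_mset_commute)
  qed
  then have "(u, u') \<in> R\<^sup>*"
    using F(3) R_sym[OF F'(3)] by (meson rtrancl_trans)
  then show ?thesis
    by (simp add: R_def D_def conj_ac)
qed

text \<open>A partition other than \<open>[n]\<close> has two rows, and a cell can go from the
  second to the first.\<close>

lemma ascending_edge_exists:
  assumes v: "v \<in> partitions n" and "v \<noteq> [n]" "n \<ge> 1"
  shows "\<exists>u. {u, v} \<in> partition_graph_edges n \<and> sq_sum v < sq_sum u"
proof -
  have v': "sorted_wrt (\<ge>) v" "0 \<notin> set v" "sum_list v = n" using v by (auto simp: partitions_def)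
  \<comment> \<open>The case rule merely splits lists into empty, singleton and longer ones.\<close>
  obtain x y zs where xy: "v = x # y # zs"
    using v' assms(2,3) by (cases v rule: remdups_adj.cases) auto
  then obtain b where "y = Suc b" using v'(2) by (cases y) auto
  then have "b < x \<and> mset v = mset zs + {#x, Suc b#}" using v'(1) xy by auto
  then show ?thesis using ascending_edge_iff[OF v] by blast
qed

lemma finite_partitions: "finite (partitions n)"
proof (rule finite_subset)
  have "length xs \<le> sum_list xs" if "0 \<notin> set xs" for xs :: "nat list"
    using that by (induction xs) auto
  then show "partitions n \<subseteq> {xs. set xs \<subseteq> {..n} \<and> length xs \<le> n}"
    by (auto simp: partitions_def member_le_sum_list)
qed (simp add: finite_lists_length_le)

lemma partition_graph_edge_vertex: "{u, v} \<in> partition_graph_edges n \<Longrightarrow> u \<in> partitions n"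
  by (auto simp: partition_graph_edges_def doubleton_eq_iff)

theorem theorem6p7:
  fixes n :: nat
  assumes "n \<ge> 1"
  shows "simply_connected (geometric_realization (partition_complex n))"
proof -
  \<comment> \<open>Reversing the order makes \<open>[n]\<close>, with the largest sum
    \<open>n^2\<close>, the minimum, and ascending links become descending ones.\<close>
  define g where "g v = n\<^sup>2 - sq_sum v" for v
  have le: "sq_sum v \<le> n\<^sup>2" if "v \<in> partitions n" for v
    using sq_sum_le[of v] that by (simp add: partitions_def)
  have g_less: "g u < g v \<longleftrightarrow> sq_sum v < sq_sum u" if "u \<in> partitions n" "v \<in> partitions n" for u v
    using le[OF that(1)] le[OF that(2)] by (auto simp: g_def)
  interpret morse_graph "partitions n" "partition_graph_edges n" g "[n]"
  proof
    show "[n] \<in> partitions n" using assms by (simp add: partitions_def)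
    show "g [n] \<le> g v" for v by (simp add: g_def sq_sum_def)
  next
    fix u v assume "u \<in> partitions n" "v \<in> partitions n" "{u, v} \<in> partition_graph_edges n"
    then show "g u \<noteq> g v"
      using sq_sum_edge_neq g_less by (metis nat_neq_iff)
  next
    fix v assume "v \<in> partitions n" "v \<noteq> [n]"
    then show "\<exists>u\<in>partitions n. {u, v} \<in> partition_graph_edges n \<and> g u < g v"
      using ascending_edge_exists assms g_less partition_graph_edge_vertex by blast
  next
    fix v u u' assume v: "v \<in> partitions n"
      and u: "u \<in> partitions n" "{u, v} \<in> partition_graph_edges n" "g u < g v"
      and u': "u' \<in> partitions n" "{u', v} \<in> partition_graph_edges n" "g u' < g v"
    show "(u, u') \<in> {(x, y). x \<in> partitions n \<and> y \<in> partitions n \<and>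
            {x, v} \<in> partition_graph_edges n \<and> {y, v} \<in> partition_graph_edges n \<and>
            g x < g v \<and> g y < g v \<and> {x, y} \<in> partition_graph_edges n}\<^sup>*"
      \<comment> \<open>The two link relations match, since ends of edges are partitions and
        \<open>g\<close> reverses the order given by \<open>sq_sum\<close>.\<close>
      by (rule subsetD[OF rtrancl_mono ascending_link_connected[OF v u(2) _ u'(2)]])
         (use v u u' g_less partition_graph_edge_vertex in auto)
  qed
  show ?thesis
    unfolding partition_complex_def
    by (rule simply_connected_geometric_realization[OF finite_partitions])
qed

end
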